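(* Let $G$ be a connected graph and $k\ge 0$ an integer. Then $$\mathsf{els}_k(G)=(-1)^{|E(G)|+|V(G)|}\sum_{U\subseteq V(G)}\mathrm{Sur}(k,|U|)\;\tilde\chi(\Delta^G_U).$$
   Context: Graphs are finite and undirected; loops and parallel edges are allowed. A nucleus of $G$ is a (nonempty) connected subgraph $N\subseteq G$ such that $V(N)$ is a vertex cover of $G$ (every edge of $G$ has at least one endpoint in $V(N)$); a single vertex with no edges is allowed as a connected subgraph. $\mathcal{N}(G)$ is the set of nuclei. For connected $G$ and integer $k\ge0$, the $k$-th Elser number is $\mathsf{els}_k(G)=(-1)^{|V(G)|+1}\sum_{N\in\mathcal{N}(G)}(-1)^{|E(N)|}|V(N)|^k$. $\mathrm{Sur}(a,b)$ is the number of surjections from a set of size $a$ to a set of size $b$, with $\mathrm{Sur}(0,0)=1$ and $\mathrm{Sur}(a,b)=0$ if exactly one of $a,b$ is zero. For a connected graph $G$ and $U\subseteq V(G)$, the $U$-nucleus complex is the simplicial complex on vertex set $E(G)$ $$\Delta^G_U=\{E(G)\setminus E(N): N\in\mathcal{N}(G),\ V(N)\supseteq U\}.$$ One exception: if $G=cK_2$ is the graph with two vertices joined by $c\ge1$ parallel edges and no loops, and $U=\emptyset$, then $G$ has two distinct nuclei with no edges (the two single vertices), and $\Delta^{cK_2}_\emptyset$ is defined to be the $\Delta$-complex consisting of two $(c-1)$-dimensional simplices on vertex set $E(cK_2)$ glued along their boundaries (one top simplex for each single-vertex nucleus, counted separately). The reduced Euler characteristic is $\tilde\chi(\Delta)=\sum_{\sigma}(-1)^{\dim\sigma}$,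 the sum over all faces $\sigma$ including the empty face, with $\dim\sigma=|\sigma|-1$. *)

theory Defs
  imports Main "HOL-Library.FuncSet" "HOL-Library.Uprod"
begin

(* Multigraphs.  The endpoints of an edge form an unordered pair; Upair v v is a loop at v. *)

record ('v, 'e) mgraph =
  verts :: "'v set"
  edges :: "'e set"
  ends  :: "'e \<Rightarrow> 'v uprod"

definition fin_graph :: "('v, 'e) mgraph \<Rightarrow> bool" where
  "fin_graph G \<longleftrightarrow> finite (verts G) \<and> finite (edges G) \<and>
     (\<forall>e\<in>edges G. set_uprod (ends G e) \<subseteq> verts G)"

definition adj_rel :: "('v, 'e) mgraph \<Rightarrow> ('v \<times> 'v) set" where
  "adj_rel G = {(u, v). \<exists>e\<in>edges G. ends G e = Upair u v}"

(* The graph without vertices does not count as connected; a single vertex without edges does. *)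
definition connected_graph :: "('v, 'e) mgraph \<Rightarrow> bool" where
  "connected_graph G \<longleftrightarrow> fin_graph G \<and> verts G \<noteq> {} \<and>
     (\<forall>u\<in>verts G. \<forall>v\<in>verts G. (u, v) \<in> (adj_rel G)\<^sup>*)"

(* A subgraph keeps the whole function ends of the ambient graph (also its irrelevant values
   outside the edge set), so that it is determined by its vertices and edges. *)
definition subgraph :: "('v, 'e) mgraph \<Rightarrow> ('v, 'e) mgraph \<Rightarrow> bool" where
  "subgraph H G \<longleftrightarrow> fin_graph H \<and> verts H \<subseteq> verts G \<and> edges H \<subseteq> edges G \<and> ends H = ends G"

definition vertex_cover :: "('v, 'e) mgraph \<Rightarrow> 'v set \<Rightarrow> bool" where
  "vertex_cover G C \<longleftrightarrow> C \<subseteq> verts G \<and> (\<forall>e\<in>edges G. \<exists>v\<in>C. v \<in> set_uprod (ends G e))"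

definition nuclei :: "('v, 'e) mgraph \<Rightarrow> ('v, 'e) mgraph set" where
  "nuclei G = {N. subgraph N G \<and> connected_graph N \<and> vertex_cover G (verts N)}"

definition els :: "nat \<Rightarrow> ('v, 'e) mgraph \<Rightarrow> int" where
  "els k G = (-1) ^ (card (verts G) + 1) *
     (\<Sum>N\<in>nuclei G. (-1) ^ card (edges N) * int (card (verts N)) ^ k)"

definition Sur :: "nat \<Rightarrow> nat \<Rightarrow> nat" where
  "Sur a b = card {f \<in> {..<a} \<rightarrow>\<^sub>E {..<b}. f ` {..<a} = {..<b}}"

lemma Sur_0_0: "Sur 0 0 = 1"
  by (simp add: Sur_def)

lemma Sur_0_right: "a > 0 \<Longrightarrow> Sur a 0 = 0"
  by (auto simp: Sur_def PiE_eq_empty_iff)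

lemma Sur_0_left: "b > 0 \<Longrightarrow> Sur 0 b = 0"
  by (auto simp: Sur_def)

(* Finite Delta-complexes in which a face has pairwise distinct vertices, but different faces
   may have the same vertices.  They are given by their faces (including the empty one), the
   vertex set of each face, and the relation of being a face of a face. *)

record ('c, 'x) cell_complex =
  faces    :: "'c set"
  vertices :: "'c \<Rightarrow> 'x set"
  face_le  :: "'c \<Rightarrow> 'c \<Rightarrow> bool"

(* The faces of a face correspond bijectively to the subsets of its vertex set, and there is
   exactly one empty face. *)
definition delta_complex :: "('c, 'x) cell_complex \<Rightarrow> bool" where
  "delta_complex D \<longleftrightarrow> finite (faces D) \<and>
     (\<forall>s\<in>faces D. finite (vertices D s)) \<and>
     (\<exists>!s. s \<in> faces D \<and> vertices D s = {}) \<and>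
     (\<forall>s\<in>faces D. \<forall>t\<in>faces D. \<forall>u\<in>faces D.
        face_le D s t \<longrightarrow> face_le D t u \<longrightarrow> face_le D s u) \<and>
     (\<forall>s\<in>faces D. face_le D s s) \<and>
     (\<forall>t\<in>faces D. bij_betw (vertices D) {s \<in> faces D. face_le D s t} (Pow (vertices D t)))"

definition face_dim :: "('c, 'x) cell_complex \<Rightarrow> 'c \<Rightarrow> int" where
  "face_dim D s = int (card (vertices D s)) - 1"

(* The conditional is (-1) to the power face_dim D s, an exponent that is -1 for the empty face. *)
definition reduced_euler_char :: "('c, 'x) cell_complex \<Rightarrow> int" where
  "reduced_euler_char D = (\<Sum>s\<in>faces D. if even (face_dim D s) then 1 else -1)"

(* A face is a vertex set with a tag.  The tag is None except for the top simplices in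
   glued_simplices, which share their vertex set. *)
type_synonym ('x, 'l) tagged_face = "'x set \<times> 'l option"

definition tagged_complex :: "('x, 'l) tagged_face set \<Rightarrow> (('x, 'l) tagged_face, 'x) cell_complex"
  where "tagged_complex F =
     \<lparr>faces = F, vertices = fst, face_le = (\<lambda>s t. s = t \<or> fst s \<subset> fst t)\<rparr>"

definition simplicial_complex :: "'x set set \<Rightarrow> (('x, 'l) tagged_face, 'x) cell_complex" where
  "simplicial_complex K = tagged_complex {(A, None) | A. A \<in> K}"

(* One simplex on the vertex set X for every l in L, all glued along their common boundary. *)
definition glued_simplices ::
  "'x set \<Rightarrow> 'l set \<Rightarrow> (('x, 'l) tagged_face, 'x) cell_complex" where
  "glued_simplices X L =
     tagged_complex ({(A, None) | A. A \<subset> X} \<union> {(X, Some l) | l. l \<in> L})"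

lemma delta_complex_tagged_complex:
  assumes "finite F" "(A0, l0) \<in> F" "\<And>A l. (A, l) \<in> F \<Longrightarrow> finite A"
    and down: "\<And>A B l. (A, l) \<in> F \<Longrightarrow> B \<subset> A \<Longrightarrow> (B, None) \<in> F"
    and uniq: "\<And>A B l m. (A, l) \<in> F \<Longrightarrow> (B, m) \<in> F \<Longrightarrow> B \<subset> A \<Longrightarrow> m = None"
    and empty: "\<And>l. ({}, l) \<in> F \<Longrightarrow> l = None"
  shows "delta_complex (tagged_complex F)"
proof -
  have e: "({}, None) \<in> F"
    using assms(2) down[of A0 l0 "{}"] empty[of l0] by (cases "A0 = {}") auto
  have "bij_betw fst {s \<in> F. s = (A, l) \<or> fst s \<subset> A} (Pow A)" if "(A, l) \<in> F" for A l
  proof (rule bij_betw_imageI)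
    show "inj_on fst {s \<in> F. s = (A, l) \<or> fst s \<subset> A}"
    proof (rule inj_onI)
      fix s t assume st: "s \<in> {s \<in> F. s = (A, l) \<or> fst s \<subset> A}"
        "t \<in> {s \<in> F. s = (A, l) \<or> fst s \<subset> A}" "fst s = fst t"
      show "s = t"
      proof (cases "fst s \<subset> A")
        case True
        moreover have "(fst s, snd s) \<in> F" "(fst t, snd t) \<in> F" using st(1,2) by simp_all
        ultimately have "snd s = None" "snd t = None"
          using uniq[OF that] st(3) by metis+
        then show ?thesis using st(3) by (simp add: prod_eq_iff)
      next
        case False
        then show ?thesis using st by auto
      qed
    qed
    show "fst ` {s \<in> F. s = (A, l) \<or> fst s \<subset> A} = Pow A"
    proof
      show "Pow A \<subseteq> fst ` {s \<in> F. s = (A, l) \<or> fst s \<subset> A}"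
      proof
        fix B assume "B \<in> Pow A"
        then consider "B = A" | "B \<subset> A" by auto
        then show "B \<in> fst ` {s \<in> F. s = (A, l) \<or> fst s \<subset> A}"
        proof cases
          case 1
          then show ?thesis using that by (intro image_eqI[of _ _ "(A, l)"]) auto
        next
          case 2
          then show ?thesis using down[OF that 2] by (intro image_eqI[of _ _ "(B, None)"]) auto
        qed
      qed
    qed auto
  qed
  moreover have "\<exists>!s. s \<in> F \<and> fst s = {}"
  proof (rule ex1I)
    show "({}, None) \<in> F \<and> fst ({}, None) = {}" using e by simp
    show "s = ({}, None)" if "s \<in> F \<and> fst s = {}" for s
      using that empty by (cases s) auto
  qed
  moreover have "finite (fst s)" if "s \<in> F" for s
    using that assms(3) by (cases s) auto
  ultimately show ?thesis
    unfolding delta_complex_def tagged_complex_def using assms(1) by auto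
qed

lemma delta_complex_simplicial_complex:
  assumes "finite K" "K \<noteq> {}" "\<And>A. A \<in> K \<Longrightarrow> finite A"
    and "\<And>A B. A \<in> K \<Longrightarrow> B \<subseteq> A \<Longrightarrow> B \<in> K"
  shows "delta_complex (simplicial_complex K)"
proof -
  obtain A where A: "A \<in> K" using assms(2) by blast
  have K: "{(A, None) | A. A \<in> K} = (\<lambda>A. (A, None)) ` K" by auto
  show ?thesis
    unfolding simplicial_complex_def
    by (rule delta_complex_tagged_complex[of _ A None])
       (use assms(1,3) A in \<open>auto simp: K intro: assms(4)\<close>)
qed

lemma delta_complex_glued_simplices:
  assumes "finite X" "X \<noteq> {}" "finite L"
  shows "delta_complex (glued_simplices X L)"
proof -
  have fin: "finite ({(A, None) | A. A \<subset> X} \<union> {(X, Some l) | l. l \<in> L})"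
    by (rule finite_subset[of _ "Pow X \<times> insert None (Some ` L)"]) (use assms in auto)
  show ?thesis
    unfolding glued_simplices_def
    by (rule delta_complex_tagged_complex[of _ "{}" None, OF fin])
       (use assms in \<open>auto intro: finite_subset\<close>)
qed

(* The graph with two vertices joined by one or more parallel edges, and no loops. *)
definition is_cK2 :: "('v, 'e) mgraph \<Rightarrow> bool" where
  "is_cK2 G \<longleftrightarrow> card (verts G) = 2 \<and> edges G \<noteq> {} \<and>
     (\<forall>e\<in>edges G. set_uprod (ends G e) = verts G)"

(* In the exceptional case the top simplices are indexed by the vertices of G, that is, by the
   nuclei without edges. *)
definition nucleus_complex ::
  "('v, 'e) mgraph \<Rightarrow> 'v set \<Rightarrow> (('e, 'v) tagged_face, 'e) cell_complex" where
  "nucleus_complex G U =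
     (if is_cK2 G \<and> U = {} then glued_simplices (edges G) (verts G)
      else simplicial_complex {edges G - edges N | N. N \<in> nuclei G \<and> U \<subseteq> verts N})"

lemma finite_nuclei:
  assumes "connected_graph G"
  shows "finite (nuclei G)"
proof (rule finite_imageD)
  let ?f = "\<lambda>N. (verts N, edges N)"
  have "?f ` nuclei G \<subseteq> Pow (verts G) \<times> Pow (edges G)"
    by (auto simp: nuclei_def subgraph_def)
  then show "finite (?f ` nuclei G)"
    by (rule finite_subset) (use assms in \<open>auto simp: connected_graph_def fin_graph_def\<close>)
  show "inj_on ?f (nuclei G)"
    by (auto simp: inj_on_def nuclei_def subgraph_def intro: mgraph.equality)
qed

lemma nucleus_self:
  assumes "connected_graph G"
  shows "G \<in> nuclei G"
proof -
  have "\<exists>v\<in>verts G. v \<in> set_uprod (ends G e)" if "e \<in> edges G" for e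
    using assms that by (cases "ends G e") (force simp: connected_graph_def fin_graph_def)
  then show ?thesis
    using assms by (auto simp: nuclei_def subgraph_def vertex_cover_def connected_graph_def)
qed

lemma nuclei_add_edges:
  assumes G: "connected_graph G" and N: "N \<in> nuclei G"
    and F: "edges N \<subseteq> F" "F \<subseteq> edges G"
  shows "\<exists>M\<in>nuclei G. edges M = F \<and> verts N \<subseteq> verts M"
proof -
  define M where "M = \<lparr>verts = verts N \<union> (\<Union>e\<in>F. set_uprod (ends G e)), edges = F, ends = ends G\<rparr>"
  have eN: "ends N = ends G" and VN: "verts N \<subseteq> verts G" and cN: "connected_graph N"
    and cov: "\<And>e. e \<in> edges G \<Longrightarrow> \<exists>v\<in>verts N. v \<in> set_uprod (ends G e)"
    using N by (auto simp: nuclei_def subgraph_def vertex_cover_def)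
  have fG: "fin_graph G" using G by (simp add: connected_graph_def)
  have VM: "verts M \<subseteq> verts G"
    using VN fG F by (auto simp: M_def fin_graph_def)
  have fM: "fin_graph M"
    using fG F VM by (auto simp: fin_graph_def M_def intro: finite_subset)
  have sub: "(adj_rel N)\<^sup>* \<subseteq> (adj_rel M)\<^sup>*"
    by (rule rtrancl_mono) (use F eN in \<open>auto simp: adj_rel_def M_def\<close>)
  have sy: "sym ((adj_rel M)\<^sup>*)"
    by (rule sym_rtrancl) (force simp: sym_def adj_rel_def)
  have near: "\<exists>w\<in>verts N. (v, w) \<in> (adj_rel M)\<^sup>*" if v: "v \<in> verts M" for v
  proof (cases "v \<in> verts N")
    case False
    then obtain e where e: "e \<in> F" "v \<in> set_uprod (ends G e)" using v by (auto simp: M_def)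
    obtain w where w: "w \<in> verts N" "w \<in> set_uprod (ends G e)" using cov e F by blast
    have "ends G e = Upair v w"
      using e(2) w False by (cases "ends G e") (auto simp: Upair_inject)
    then have "(v, w) \<in> adj_rel M" using e by (auto simp: adj_rel_def M_def)
    then show ?thesis using w by blast
  qed auto
  have "(u, v) \<in> (adj_rel M)\<^sup>*" if uv: "u \<in> verts M" "v \<in> verts M" for u v
  proof -
    obtain a b where ab: "a \<in> verts N" "(u, a) \<in> (adj_rel M)\<^sup>*"
      "b \<in> verts N" "(v, b) \<in> (adj_rel M)\<^sup>*" using near uv by meson
    have "(a, b) \<in> (adj_rel M)\<^sup>*" using ab cN sub by (auto simp: connected_graph_def)
    moreover have "(b, v) \<in> (adj_rel M)\<^sup>*" using ab sy by (auto dest: symD)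
    ultimately show ?thesis using ab by (meson rtrancl_trans)
  qed
  moreover have "verts M \<noteq> {}" using cN by (auto simp: connected_graph_def M_def)
  ultimately have "connected_graph M" using fM by (auto simp: connected_graph_def)
  then have "M \<in> nuclei G"
    using fM VM F cov by (force simp: nuclei_def subgraph_def vertex_cover_def M_def)
  then show ?thesis by (intro bexI[of _ M]) (auto simp: M_def)
qed

lemma delta_complex_nucleus_complex:
  assumes G: "connected_graph G" and U: "U \<subseteq> verts G"
  shows "delta_complex (nucleus_complex G U)"
proof -
  let ?K = "{edges G - edges N | N. N \<in> nuclei G \<and> U \<subseteq> verts N}"
  have fin: "finite (edges G)" "finite (verts G)"
    using G by (auto simp: connected_graph_def fin_graph_def)
  have "delta_complex (simplicial_complex ?K :: (('b, 'a) tagged_face, 'b) cell_complex)"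
  proof (rule delta_complex_simplicial_complex)
    show "finite ?K"
      by (rule finite_subset[of _ "Pow (edges G)"]) (use fin in auto)
    show "?K \<noteq> {}" using nucleus_self[OF G] U by auto
    show "finite A" if "A \<in> ?K" for A using that fin by auto
    fix A B assume "A \<in> ?K" and B: "B \<subseteq> A"
    then obtain N where N: "N \<in> nuclei G" "U \<subseteq> verts N" "A = edges G - edges N" by auto
    have "edges N \<subseteq> edges G - B" using N B by (auto simp: nuclei_def subgraph_def)
    then obtain M where "M \<in> nuclei G" "edges M = edges G - B" "verts N \<subseteq> verts M"
      using nuclei_add_edges[OF G N(1), of "edges G - B"] by auto
    moreover have "B = edges G - (edges G - B)" using N B by auto
    ultimately show "B \<in> ?K" using N(2) by (metis (mono_tags, lifting) mem_Collect_eq order_trans)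
  qed
  then show ?thesis
    using fin by (auto simp: nucleus_complex_def is_cK2_def intro: delta_complex_glued_simplices)
qed

end

theory Submission
  imports Defs
begin

text \<open>A map from a \<open>k\<close>-element set to \<open>V(N)\<close> is the same as a subset \<open>U \<subseteq> V(N)\<close>, its image,
together with a surjection onto \<open>U\<close>.  Hence \<open>|V(N)|\<^sup>k\<close> is the sum of \<open>Sur(k, |U|)\<close> over
\<open>U \<subseteq> V(N)\<close> (lemma \<open>power_card_eq_sum_Sur\<close>).  Inserting this in the Elser number and exchanging
the two sums leaves, for each \<open>U\<close>, the sum of \<open>(-1)\<^bsup>|E(N)|\<^esup>\<close> over the nuclei \<open>N\<close> with
\<open>U \<subseteq> V(N)\<close>.

These nuclei correspond bijectively to the faces of the \<open>U\<close>-nucleus complex, the nucleus \<open>N\<close>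
giving a face with vertex set \<open>E(G) - E(N)\<close>, so that the inner sum is the reduced Euler
characteristic up to the sign \<open>(-1)\<^bsup>|E(G)| + 1\<^esup>\<close> (lemma \<open>reduced_euler_char_nucleus_complex\<close>).
That the correspondence is injective is the one graph theoretic point.  A connected graph with an
edge is determined by its edges, while one without edges is a single vertex.  Two distinct
vertices can both cover all edges only if every edge joins these two, that is, only in a graph
\<open>cK\<^sub>2\<close>; and a nonempty \<open>U\<close> excludes one of them.  For \<open>U = {}\<close> in \<open>cK\<^sub>2\<close> injectivity fails for
plain edge sets, and the second top simplex of the exceptional complex makes up for it.\<close>


section \<open>Powers as sums of surjection numbers\<close>

lemma restrict_comp_surjection:
  assumes f: "f \<in> {f \<in> A \<rightarrow>\<^sub>E B. f ` A = B}" and h: "h ` B = C"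
  shows "restrict (h \<circ> f) A \<in> {f \<in> A \<rightarrow>\<^sub>E C. f ` A = C}"
proof -
  have "restrict (h \<circ> f) A ` A = h ` f ` A" by (simp add: image_image)
  also have "\<dots> = C" using f h by simp
  finally show ?thesis by (auto simp: PiE_def)
qed

lemma card_surjections_eq_Sur:
  assumes "finite U"
  shows "card {f \<in> {..<k} \<rightarrow>\<^sub>E U. f ` {..<k} = U} = Sur k (card U)"
proof -
  obtain h where h: "bij_betw h {..<card U} U"
    using ex_bij_betw_nat_finite[OF assms] by (auto simp: atLeast0LessThan)
  define g where "g = the_inv_into {..<card U} h"
  have g: "bij_betw g U {..<card U}"
    unfolding g_def by (rule bij_betw_the_inv_into[OF h])
  have hg: "h (g x) = x" if "x \<in> U" for x
    unfolding g_def using h that by (simp add: f_the_inv_into_f_bij_betw)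
  have gh: "g (h x) = x" if "x < card U" for x
    unfolding g_def using h that by (simp add: the_inv_into_f_f bij_betw_def)
  let ?S = "\<lambda>U. {f \<in> {..<k} \<rightarrow>\<^sub>E U. f ` {..<k} = U}"
  have "bij_betw (\<lambda>f. restrict (h \<circ> f) {..<k}) (?S {..<card U}) (?S U)"
  proof (rule bij_betw_byWitness[where f' = "\<lambda>f. restrict (g \<circ> f) {..<k}"])
    show "\<forall>f\<in>?S {..<card U}. restrict (g \<circ> restrict (h \<circ> f) {..<k}) {..<k} = f"
      by (auto simp: gh fun_eq_iff restrict_def PiE_def extensional_def dest: Pi_mem)
    show "\<forall>f\<in>?S U. restrict (h \<circ> restrict (g \<circ> f) {..<k}) {..<k} = f"
      by (auto simp: hg fun_eq_iff restrict_def PiE_def extensional_def dest: Pi_mem)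
    show "(\<lambda>f. restrict (h \<circ> f) {..<k}) ` ?S {..<card U} \<subseteq> ?S U"
      by (rule image_subsetI) (rule restrict_comp_surjection[OF _ bij_betw_imp_surj_on[OF h]])
    show "(\<lambda>f. restrict (g \<circ> f) {..<k}) ` ?S U \<subseteq> ?S {..<card U}"
      by (rule image_subsetI) (rule restrict_comp_surjection[OF _ bij_betw_imp_surj_on[OF g]])
  qed
  then show ?thesis by (simp add: Sur_def bij_betw_same_card)
qed

text \<open>The maps from a \<open>k\<close>-element set to \<open>V\<close> are sorted by their image.\<close>

lemma power_card_eq_sum_Sur:
  assumes "finite V"
  shows "card V ^ k = (\<Sum>U\<in>Pow V. Sur k (card U))"
proof -
  let ?S = "\<lambda>U. {f \<in> {..<k} \<rightarrow>\<^sub>E U. f ` {..<k} = U}"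
  have "{..<k} \<rightarrow>\<^sub>E V = (\<Union>U\<in>Pow V. ?S U)" by (auto simp: PiE_def Pi_def)
  then have "card V ^ k = card (\<Union>U\<in>Pow V. ?S U)"
    by (metis card_funcsetE card_lessThan finite_lessThan)
  also have "\<dots> = (\<Sum>U\<in>Pow V. card (?S U))"
  proof (rule card_UN_disjoint)
    have "finite (?S U)" if "finite U" for U
      by (rule finite_subset[OF _ finite_PiE[of "{..<k}" "\<lambda>_. U"]]) (use that in auto)
    then show "\<forall>U\<in>Pow V. finite (?S U)" using assms by (auto dest: finite_subset)
  qed (use assms in auto)
  also have "\<dots> = (\<Sum>U\<in>Pow V. Sur k (card U))"
    using assms by (intro sum.cong refl card_surjections_eq_Sur) (auto dest: finite_subset)
  finally show ?thesis .
qed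


section \<open>Nuclei and their edge sets\<close>

lemma connected_graph_no_edges:
  assumes "connected_graph H" "edges H = {}"
  obtains v where "verts H = {v}"
proof -
  have "adj_rel H = {}" using assms(2) by (simp add: adj_rel_def)
  then have "u = v" if "u \<in> verts H" "v \<in> verts H" for u v
    using assms(1) that by (auto simp: connected_graph_def)
  moreover obtain v where "v \<in> verts H" using assms(1) by (auto simp: connected_graph_def)
  ultimately have "verts H = {v}" by blast
  then show thesis by (rule that)
qed

text \<open>A vertex \<open>v\<close> either is the endpoint of some chosen edge, or lies on the first edge of a walk
from \<open>v\<close> to that endpoint.\<close>

lemma connected_graph_verts_eq_endpoints:
  assumes H: "connected_graph H" and "edges H \<noteq> {}"
  shows "verts H = (\<Union>e\<in>edges H. set_uprod (ends H e))"
proof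
  show "(\<Union>e\<in>edges H. set_uprod (ends H e)) \<subseteq> verts H"
    using H by (auto simp: connected_graph_def fin_graph_def)
  show "verts H \<subseteq> (\<Union>e\<in>edges H. set_uprod (ends H e))"
  proof
    fix v assume v: "v \<in> verts H"
    obtain e where e: "e \<in> edges H" using assms(2) by blast
    obtain a where a: "a \<in> set_uprod (ends H e)" by (cases "ends H e") auto
    have "a \<in> verts H" using H e a by (auto simp: connected_graph_def fin_graph_def)
    then have "(v, a) \<in> (adj_rel H)\<^sup>*" using H v by (simp add: connected_graph_def)
    then show "v \<in> (\<Union>e\<in>edges H. set_uprod (ends H e))"
    proof (cases rule: converse_rtranclE)
      case base
      then show ?thesis using e a by blast
    next
      case (step y)
      then obtain e' where "e' \<in> edges H" "ends H e' = Upair v y" by (auto simp: adj_rel_def)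
      then show ?thesis by force
    qed
  qed
qed

lemma nuclei_eqI:
  assumes "M \<in> nuclei G" "N \<in> nuclei G" "verts M = verts N" "edges M = edges N"
  shows "M = N"
  using assms by (auto simp: nuclei_def subgraph_def intro: mgraph.equality)

lemma nuclei_eq_if_edges_eq:
  assumes "M \<in> nuclei G" "N \<in> nuclei G" "edges M = edges N" "edges N \<noteq> {}"
  shows "M = N"
proof (rule nuclei_eqI[OF assms(1,2) _ assms(3)])
  have "connected_graph M" "connected_graph N" "ends M = ends N"
    using assms(1,2) by (auto simp: nuclei_def subgraph_def)
  then show "verts M = verts N"
    using assms(3,4) by (simp add: connected_graph_verts_eq_endpoints)
qed

text \<open>Both \<open>v\<close> and \<open>w\<close> lie on every edge, so every edge joins \<open>v\<close> and \<open>w\<close>, and by connectedness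
there is no third vertex.\<close>

lemma is_cK2_if_two_vertex_nuclei:
  assumes G: "connected_graph G" and "M \<in> nuclei G" "N \<in> nuclei G"
    and vw: "verts M = {v}" "verts N = {w}" "v \<noteq> w"
  shows "is_cK2 G"
proof -
  have sub: "{v, w} \<subseteq> verts G" using assms by (auto simp: nuclei_def subgraph_def)
  have ends: "set_uprod (ends G e) = {v, w}" if "e \<in> edges G" for e
  proof -
    have "v \<in> set_uprod (ends G e)" "w \<in> set_uprod (ends G e)"
      using assms that by (auto simp: nuclei_def vertex_cover_def)
    then show ?thesis using vw(3) by (cases "ends G e") auto
  qed
  have ne: "edges G \<noteq> {}"
  proof
    assume "edges G = {}"
    then obtain u where "verts G = {u}" by (rule connected_graph_no_edges[OF G])
    then show False using sub vw(3) by auto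
  qed
  have "verts G = {v, w}"
    using connected_graph_verts_eq_endpoints[OF G ne] ends ne by auto
  then show ?thesis using ends ne vw(3) by (simp add: is_cK2_def)
qed

lemma inj_on_edges_nuclei:
  assumes G: "connected_graph G" and U: "\<not> (is_cK2 G \<and> U = {})"
  shows "inj_on edges {N \<in> nuclei G. U \<subseteq> verts N}"
proof (rule inj_onI)
  fix M N
  assume "M \<in> {N \<in> nuclei G. U \<subseteq> verts N}" "N \<in> {N \<in> nuclei G. U \<subseteq> verts N}"
    and eq: "edges M = edges N"
  then have M: "M \<in> nuclei G" "U \<subseteq> verts M" and N: "N \<in> nuclei G" "U \<subseteq> verts N" by auto
  show "M = N"
  proof (cases "edges N = {}")
    case True
    have "connected_graph M" "connected_graph N" using M N by (auto simp: nuclei_def)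
    then obtain v w where vw: "verts M = {v}" "verts N = {w}"
      using True eq connected_graph_no_edges by metis
    have "v = w"
    proof (rule ccontr)
      assume "v \<noteq> w"
      moreover from this have "U = {}" using M N vw by auto
      ultimately show False using U is_cK2_if_two_vertex_nuclei[OF G M(1) N(1) vw] by blast
    qed
    then show ?thesis using nuclei_eqI[OF M(1) N(1)] vw eq by simp
  next
    case False
    then show ?thesis by (rule nuclei_eq_if_edges_eq[OF M(1) N(1) eq])
  qed
qed

lemma is_cK2_vertex_nucleus:
  assumes "connected_graph G" "is_cK2 G" "v \<in> verts G"
  shows "\<lparr>verts = {v}, edges = {}, ends = ends G\<rparr> \<in> nuclei G"
  using assms
  by (auto simp: nuclei_def subgraph_def connected_graph_def fin_graph_def vertex_cover_def
      is_cK2_def)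

text \<open>The edge sets of nuclei of \<open>cK\<^sub>2\<close> are arbitrary: the empty one occurs once for each vertex,
and every other one exactly once, since it can be added to a vertex.\<close>

lemma bij_betw_nuclei_cK2_faces:
  assumes G: "connected_graph G" and cK2: "is_cK2 G"
  shows "bij_betw
    (\<lambda>N. (edges G - edges N, if edges N = {} then Some (the_elem (verts N)) else None))
    (nuclei G) (faces (glued_simplices (edges G) (verts G)))"
    (is "bij_betw ?f _ _")
proof (rule bij_betw_imageI)
  have sub: "edges N \<subseteq> edges G" "verts N \<subseteq> verts G" "connected_graph N" if "N \<in> nuclei G" for N
    using that by (auto simp: nuclei_def subgraph_def)
  have vertex: "\<exists>v\<in>verts G. verts N = {v}" if "N \<in> nuclei G" "edges N = {}" for N
    by (rule connected_graph_no_edges[OF sub(3)[OF that(1)] that(2)]) (use sub(2)[OF that(1)] in auto)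
  have faces: "faces (glued_simplices (edges G) (verts G)) =
      {(A, None) | A. A \<subset> edges G} \<union> {(edges G, Some v) | v. v \<in> verts G}"
    by (simp add: glued_simplices_def tagged_complex_def)
  show "inj_on ?f (nuclei G)"
  proof (rule inj_onI)
    fix M N assume M: "M \<in> nuclei G" and N: "N \<in> nuclei G" and eq: "?f M = ?f N"
    have E: "edges M = edges N" using eq sub(1)[OF M] sub(1)[OF N] by auto
    show "M = N"
    proof (cases "edges N = {}")
      case True
      then have "verts M = verts N" using vertex[OF M] vertex[OF N] eq E by auto
      then show ?thesis by (rule nuclei_eqI[OF M N _ E])
    next
      case False
      then show ?thesis by (rule nuclei_eq_if_edges_eq[OF M N E])
    qed
  qed
  show "?f ` nuclei G = faces (glued_simplices (edges G) (verts G))"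
  proof
    show "?f ` nuclei G \<subseteq> faces (glued_simplices (edges G) (verts G))"
    proof
      fix s assume "s \<in> ?f ` nuclei G"
      then obtain N where N: "N \<in> nuclei G" and s: "s = ?f N" by blast
      show "s \<in> faces (glued_simplices (edges G) (verts G))"
        using vertex[OF N] sub(1)[OF N] by (cases "edges N = {}") (auto simp: faces s)
    qed
    show "faces (glued_simplices (edges G) (verts G)) \<subseteq> ?f ` nuclei G"
    proof
      fix s assume "s \<in> faces (glued_simplices (edges G) (verts G))"
      then consider A where "s = (A, None)" "A \<subset> edges G"
        | v where "s = (edges G, Some v)" "v \<in> verts G"
        by (auto simp: faces)
      then show "s \<in> ?f ` nuclei G"
      proof cases
        case (1 A)
        obtain v where "v \<in> verts G" using G by (auto simp: connected_graph_def)
        then obtain M where "M \<in> nuclei G" "edges M = edges G - A"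
          using nuclei_add_edges[OF G is_cK2_vertex_nucleus[OF G cK2], of v "edges G - A"] by auto
        then show ?thesis using 1 by (intro image_eqI[of _ _ M]) auto
      next
        case (2 v)
        then show ?thesis
          using is_cK2_vertex_nucleus[OF G cK2]
          by (intro image_eqI[of _ _ "\<lparr>verts = {v}, edges = {}, ends = ends G\<rparr>"]) auto
      qed
    qed
  qed
qed


section \<open>The reduced Euler characteristic\<close>

lemma reduced_euler_char_eq_sum_power:
  "reduced_euler_char D = - (\<Sum>s\<in>faces D. (-1) ^ card (vertices D s))"
proof -
  have "(if even (face_dim D s) then 1 else -1) = - ((-1) ^ card (vertices D s) :: int)" for s
    by (simp add: face_dim_def)
  then show ?thesis by (simp add: reduced_euler_char_def sum_negf)
qed

text \<open>The sum over the faces is pulled back to the nuclei along a bijection that sends \<open>N\<close> to a face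
with vertex set \<open>E(G) - E(N)\<close>; only the tag of that face depends on whether the complex is the
exceptional one.\<close>

lemma reduced_euler_char_nucleus_complex:
  assumes G: "connected_graph G"
  shows "reduced_euler_char (nucleus_complex G U) =
    (-1) ^ (card (edges G) + 1) * (\<Sum>N | N \<in> nuclei G \<and> U \<subseteq> verts N. (-1) ^ card (edges N))"
proof -
  let ?D = "nucleus_complex G U" and ?N = "{N \<in> nuclei G. U \<subseteq> verts N}"
  have fin: "finite (edges G)" using G by (simp add: connected_graph_def fin_graph_def)
  have sub: "edges N \<subseteq> edges G" if "N \<in> nuclei G" for N
    using that by (auto simp: nuclei_def subgraph_def)
  have sign: "(-1) ^ card (edges G - edges N) = ((-1) ^ card (edges G) * (-1) ^ card (edges N) :: int)"
    if "N \<in> nuclei G" for N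
  proof -
    have "card (edges G) = card (edges N) + card (edges G - edges N)"
      using sub[OF that] fin by (metis card_Diff_subset card_mono finite_subset le_add_diff_inverse)
    then show ?thesis by (simp add: power_add)
  qed
  have vert: "vertices ?D s = fst s" for s
    by (simp add: nucleus_complex_def glued_simplices_def simplicial_complex_def tagged_complex_def)
  obtain f where f: "bij_betw f ?N (faces ?D)" "\<And>N. fst (f N) = edges G - edges N"
  proof (cases "is_cK2 G \<and> U = {}")
    case True
    then show thesis
      using bij_betw_nuclei_cK2_faces[OF G] that by (force simp: nucleus_complex_def)
  next
    case False
    have "inj_on (\<lambda>N. (edges G - edges N, None)) ?N"
    proof (rule inj_onI)
      fix M N assume MN: "M \<in> ?N" "N \<in> ?N"
        "(edges G - edges M, None) = (edges G - edges N, None)"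
      then have "edges M = edges N" using sub[of M] sub[of N] by auto
      then show "M = N" using inj_on_edges_nuclei[OF G False] MN by (auto dest: inj_onD)
    qed
    then have "bij_betw (\<lambda>N. (edges G - edges N, None)) ?N (faces ?D)"
      using False
      by (auto simp: bij_betw_def nucleus_complex_def simplicial_complex_def tagged_complex_def)
    then show thesis by (rule that) simp
  qed
  have "reduced_euler_char ?D = - (\<Sum>s\<in>faces ?D. (-1) ^ card (fst s))"
    by (simp add: reduced_euler_char_eq_sum_power vert)
  also have "(\<Sum>s\<in>faces ?D. (-1) ^ card (fst s)) =
      (\<Sum>N\<in>?N. (-1) ^ card (edges G - edges N) :: int)"
    by (simp add: sum.reindex_bij_betw[OF f(1), symmetric] f(2))
  also have "\<dots> = (-1) ^ card (edges G) * (\<Sum>N\<in>?N. (-1) ^ card (edges N))"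
    by (simp add: sum_distrib_left sign)
  finally show ?thesis by simp
qed


section \<open>Elser numbers\<close>

theorem theorem3p4:
  fixes G :: "('v, 'e) mgraph" and k :: nat
  assumes "connected_graph G"
  shows "els k G = (-1) ^ (card (edges G) + card (verts G)) *
    (\<Sum>U\<in>Pow (verts G). int (Sur k (card U)) * reduced_euler_char (nucleus_complex G U))"
proof -
  let ?V = "verts G" and ?S = "\<lambda>U. int (Sur k (card U))"
    and ?e = "\<lambda>N. (-1) ^ card (edges N) :: int"
  have finV: "finite ?V" using assms by (simp add: connected_graph_def fin_graph_def)
  have pow: "int (card (verts N)) ^ k = (\<Sum>U | U \<in> Pow ?V \<and> U \<subseteq> verts N. ?S U)"
    if "N \<in> nuclei G" for N
  proof -
    have sub: "verts N \<subseteq> ?V" using that by (auto simp: nuclei_def subgraph_def)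
    then have "Pow (verts N) = {U. U \<in> Pow ?V \<and> U \<subseteq> verts N}" by auto
    moreover have "int (card (verts N)) ^ k = (\<Sum>U\<in>Pow (verts N). ?S U)"
      using power_card_eq_sum_Sur[OF finite_subset[OF sub finV], of k]
      by (metis of_nat_power of_nat_sum)
    ultimately show ?thesis by simp
  qed
  have "(\<Sum>N\<in>nuclei G. ?e N * int (card (verts N)) ^ k) =
      (\<Sum>N\<in>nuclei G. \<Sum>U | U \<in> Pow ?V \<and> U \<subseteq> verts N. ?S U * ?e N)"
    by (intro sum.cong refl) (simp add: pow sum_distrib_left mult.commute)
  also have "\<dots> = (\<Sum>U\<in>Pow ?V. \<Sum>N | N \<in> nuclei G \<and> U \<subseteq> verts N. ?S U * ?e N)"
    using finite_nuclei[OF assms] finV by (intro sum.swap_restrict) auto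
  also have "\<dots> = (\<Sum>U\<in>Pow ?V. ?S U *
      ((-1) ^ (card (edges G) + 1) * reduced_euler_char (nucleus_complex G U)))"
  proof (rule sum.cong[OF refl])
    fix U
    let ?T = "\<Sum>N | N \<in> nuclei G \<and> U \<subseteq> verts N. ?e N"
    have "(-1) ^ (card (edges G) + 1) * reduced_euler_char (nucleus_complex G U) =
        ((-1) ^ (card (edges G) + 1) * (-1) ^ (card (edges G) + 1)) * ?T"
      unfolding reduced_euler_char_nucleus_complex[OF assms] by (rule mult.assoc[symmetric])
    also have "\<dots> = ?T" by (simp flip: power_mult_distrib)
    finally show "(\<Sum>N | N \<in> nuclei G \<and> U \<subseteq> verts N. ?S U * ?e N) =
        ?S U * ((-1) ^ (card (edges G) + 1) * reduced_euler_char (nucleus_complex G U))"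
      by (simp only: sum_distrib_left)
  qed
  also have "\<dots> = (-1) ^ (card (edges G) + 1) *
      (\<Sum>U\<in>Pow ?V. ?S U * reduced_euler_char (nucleus_complex G U))"
    by (simp add: sum_distrib_left mult.left_commute)
  finally show ?thesis by (simp add: els_def power_add)
qed

end
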